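(* Let $\alpha>0$, let $s>0$ be a step size, and let $f:\mathbb{R}^d\to\mathbb{R}$ be a function with a minimizer $x^*$. Given $x_0,v_0\in\mathbb{R}^d$, let $(x_n,v_n)_{n\ge0}$ be generated by $$\begin{aligned} x_n' &= x_n + s v_n,\\ v_n' &= v_n - (1+s\sqrt{\alpha})^{-1}\left(s\sqrt{\alpha}\,v_n + s g_n\right) - s\sqrt{\alpha}\,v_n',\\ x_{n+1} &= x_n' - \delta_n,\\ v_{n+1} &= v_n' + (1+s\sqrt{\alpha})^{-1}\sqrt{\alpha}\,\delta_n, \end{aligned}$$ where $g_n,\delta_n\in\mathbb{R}^d$ are chosen so that at every iteration $n\ge 0$ the following condition holds: $$\text{for all } z\in\mathbb{R}^d:\quad f(x_n'-\delta_n)-f(z)\le \langle g_n,x_n'-z\rangle-\frac{\alpha}{2}\|x_n'-z\|^2-\frac{s^2}{2}\|g_n\|^2 .$$ Set $$L_n = f(x_n)-f(x^* )+\tfrac12\left\|\sqrt{\alpha}(x_n-x^* )+(1+s\sqrt{\alpha})v_n\right\|^2 .$$ Then for all $n\ge0$, $$L_{n+1}\le(1+s\sqrt{\alpha})^{-1}L_n .$$ In particular, if $v_0=0$, then for all $n\ge0$, $$f(x_n)-f(x^* )\le\left(1+s\sqrt{\alpha}\right)^{-n}\left(f(x_0)-f(x^* )+\frac{\alpha}{2}\|x_0-x^*\|^2\right).$$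
   Context: Here $\|\cdot\|$ and $\langle\cdot,\cdot\rangle$ are the Euclidean norm and inner product on $\mathbb{R}^d$. The second line of the iteration is an implicit (linear) equation which uniquely determines $v_n'$, since $1+s\sqrt\alpha>0$. No strong convexity, convexity or smoothness of $f$ is assumed separately, and $g_n$ is not required to be a subgradient of $f$ at $x_n'$. *)

theory Defs
  imports "HOL-Analysis.Analysis"
begin

definition lyapunov ::
  "real \<Rightarrow> real \<Rightarrow> (real ^ 'd \<Rightarrow> real) \<Rightarrow> real ^ 'd \<Rightarrow> real ^ 'd \<Rightarrow> real ^ 'd \<Rightarrow> real"
  where "lyapunov \<alpha> s f xstar x v =
    f x - f xstar
      + 1 / 2 * (norm (sqrt \<alpha> *\<^sub>R (x - xstar) + (1 + s * sqrt \<alpha>) *\<^sub>R v))\<^sup>2"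

end

theory Submission
  imports Defs
begin

text \<open>
  Write \<open>r = sqrt \<alpha>\<close>, \<open>k = 1 + s r\<close> and \<open>y = x'\<^sub>n - x\<^sup>*\<close>. The vectors inside the norms of \<open>L\<^sub>n\<close> and
  \<open>L\<^sub>n\<^sub>+\<^sub>1\<close> are \<open>r y + v\<^sub>n\<close> and \<open>r y + (v\<^sub>n - s g\<^sub>n) / k\<close>; in particular \<open>\<delta>\<^sub>n\<close> cancels. Adding the
  descent condition at \<open>z = x\<^sub>n\<close> to \<open>s r\<close> times the descent condition at \<open>z = x\<^sup>*\<close>, all terms
  involving \<open>y\<close> cancel, and \<open>k L\<^sub>n\<^sub>+\<^sub>1 - L\<^sub>n\<close> is at most half of
  \<open>(1 / k - 1) |v\<^sub>n - s g\<^sub>n|\<^sup>2 - \<alpha> s\<^sup>2 |v\<^sub>n|\<^sup>2 - s\<^sup>3 r |g\<^sub>n|\<^sup>2 \<le> 0\<close>.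
\<close>

text \<open>One iteration, detached from the sequences: \<open>F\<close> and \<open>F'\<close> are
  the gaps to the minimum before and after it, \<open>Fx\<close> is the descent condition at
  \<open>z = x n\<close>, and \<open>Fmin\<close> the one at \<open>z = xstar\<close>.\<close>

lemma lyapunov_step_inner:
  fixes y v g :: "'a::real_inner"
  assumes r: "r \<ge> 0" and s: "s \<ge> 0"
    and Fx: "F' - F \<le> g \<bullet> (s *\<^sub>R v) - r\<^sup>2 / 2 * (norm (s *\<^sub>R v))\<^sup>2 - s\<^sup>2 / 2 * (norm g)\<^sup>2"
    and Fmin: "F' \<le> g \<bullet> y - r\<^sup>2 / 2 * (norm y)\<^sup>2 - s\<^sup>2 / 2 * (norm g)\<^sup>2"
  shows "F' + 1 / 2 * (norm (r *\<^sub>R y + inverse (1 + s * r) *\<^sub>R (v - s *\<^sub>R g)))\<^sup>2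
    \<le> inverse (1 + s * r) * (F + 1 / 2 * (norm (r *\<^sub>R y + v))\<^sup>2)"
proof -
  define k where "k = 1 + s * r"
  have k: "k \<ge> 1" using r s by (simp add: k_def)
  define u where "u = v - s *\<^sub>R g"
  define W where "W = r *\<^sub>R y + inverse k *\<^sub>R u"
  have "k * (norm W)\<^sup>2 = k * r\<^sup>2 * (y \<bullet> y) + 2 * r * (y \<bullet> u) + inverse k * (u \<bullet> u)"
    using k unfolding W_def power2_norm_eq_inner
    by (simp add: inner_add_left inner_add_right inner_commute field_simps power2_eq_square)
  \<comment> \<open>Raising the coefficient of \<open>u \<bullet> u\<close> to 1 lets its
    \<open>v \<bullet> v\<close> part match the one in \<open>V\<close>.\<close>
  also have "\<dots> \<le> k * r\<^sup>2 * (y \<bullet> y) + 2 * r * (y \<bullet> u) + u \<bullet> u"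
  proof -
    have "inverse k * (u \<bullet> u) \<le> 1 * (u \<bullet> u)"
      using k by (intro mult_right_mono) (auto simp: inverse_le_1_iff)
    then show ?thesis by simp
  qed
  finally have W: "k * (norm W)\<^sup>2 \<le> k * r\<^sup>2 * (y \<bullet> y) + 2 * r * (y \<bullet> u) + u \<bullet> u" .
  have V: "(norm (r *\<^sub>R y + v))\<^sup>2 = r\<^sup>2 * (y \<bullet> y) + 2 * r * (y \<bullet> v) + v \<bullet> v"
    unfolding power2_norm_eq_inner
    by (simp add: inner_add_left inner_add_right inner_commute field_simps power2_eq_square)
  have yu: "y \<bullet> u = y \<bullet> v - s * (g \<bullet> y)"
    and uu: "u \<bullet> u = v \<bullet> v - 2 * s * (g \<bullet> v) + s\<^sup>2 * (g \<bullet> g)"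
    by (simp_all add: u_def inner_diff_left inner_diff_right inner_commute field_simps
        power2_eq_square)
  \<comment> \<open>The weight \<open>s * r\<close> is \<open>k - 1\<close>: it splits
    \<open>k * F'\<close> into \<open>F'\<close>, bounded through \<open>Fx\<close>, and
    \<open>s * r * F'\<close>. It also offsets the excess \<open>(k - 1) * r\<^sup>2\<close> of the
    \<open>y \<bullet> y\<close> coefficient in \<open>W\<close> over that in
    \<open>V\<close>.\<close>
  have "s * r * F' \<le> s * r * (g \<bullet> y - r\<^sup>2 / 2 * (norm y)\<^sup>2 - s\<^sup>2 / 2 * (norm g)\<^sup>2)"
    using Fmin r s by (intro mult_left_mono) auto
  then have min: "s * r * F' \<le> s * r * (g \<bullet> y) - s * r * r\<^sup>2 / 2 * (y \<bullet> y)
      - s * r * s\<^sup>2 / 2 * (g \<bullet> g)"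
    unfolding power2_norm_eq_inner by (simp add: algebra_simps)
  have "0 \<le> r\<^sup>2 / 2 * (norm (s *\<^sub>R v))\<^sup>2"
    by simp
  with Fx have "F' - F \<le> g \<bullet> (s *\<^sub>R v) - s\<^sup>2 / 2 * (norm g)\<^sup>2"
    by linarith
  then have cur: "F' - F \<le> s * (g \<bullet> v) - s\<^sup>2 / 2 * (g \<bullet> g)"
    unfolding power2_norm_eq_inner by simp
  have nonneg: "s * r * s\<^sup>2 / 2 * (g \<bullet> g) \<ge> 0"
    using r s by simp
  \<comment> \<open>The deficit is exactly the sum of the slacks in \<open>W\<close>,
    \<open>min\<close> and \<open>cur\<close>, the first halved, and the term of
    \<open>nonneg\<close>.\<close>
  have "F + 1 / 2 * (norm (r *\<^sub>R y + v))\<^sup>2 - k * (F' + 1 / 2 * (norm W)\<^sup>2)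
      = 1 / 2 * (k * r\<^sup>2 * (y \<bullet> y) + 2 * r * (y \<bullet> u) + u \<bullet> u - k * (norm W)\<^sup>2)
        + (s * r * (g \<bullet> y) - s * r * r\<^sup>2 / 2 * (y \<bullet> y) - s * r * s\<^sup>2 / 2 * (g \<bullet> g) - s * r * F')
        + (s * (g \<bullet> v) - s\<^sup>2 / 2 * (g \<bullet> g) - (F' - F))
        + s * r * s\<^sup>2 / 2 * (g \<bullet> g)"
    unfolding V yu uu k_def by (simp add: field_simps)
  also have "\<dots> \<ge> 0"
    using W min cur nonneg
    by (intro add_nonneg_nonneg mult_nonneg_nonneg [of "1 / 2"])
      (simp only: diff_ge_0_iff_ge | simp)+
  finally have "k * (F' + 1 / 2 * (norm W)\<^sup>2) \<le> F + 1 / 2 * (norm (r *\<^sub>R y + v))\<^sup>2"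
    by (simp only: diff_ge_0_iff_ge)
  then show ?thesis
    using k unfolding W_def u_def k_def by (simp add: field_simps)
qed

text \<open>Moving \<open>c *\<^sub>R v'\<close> to the left and writing \<open>v\<close> as
  \<open>inverse (1 + c) *\<^sub>R ((1 + c) *\<^sub>R v)\<close> cancels
  \<open>c *\<^sub>R v\<close>. The multiple \<open>(1 + c) *\<^sub>R v'\<close> is the form in
  which the velocity enters the Lyapunov function.\<close>

lemma implicit_velocity_eq:
  fixes v v' g :: "'a::real_vector"
  assumes "1 + c \<noteq> 0"
    and "v' = v - inverse (1 + c) *\<^sub>R (c *\<^sub>R v + s *\<^sub>R g) - c *\<^sub>R v'"
  shows "(1 + c) *\<^sub>R v' = inverse (1 + c) *\<^sub>R (v - s *\<^sub>R g)"
proof -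
  have "(1 + c) *\<^sub>R v' = v - inverse (1 + c) *\<^sub>R (c *\<^sub>R v + s *\<^sub>R g)"
    using assms(2) by (simp add: scaleR_add_left algebra_simps)
  also have "\<dots> = inverse (1 + c) *\<^sub>R ((1 + c) *\<^sub>R v)
      - inverse (1 + c) *\<^sub>R (c *\<^sub>R v + s *\<^sub>R g)"
    using assms(1) by simp
  also have "\<dots> = inverse (1 + c) *\<^sub>R (v - s *\<^sub>R g)"
    by (simp only: scaleR_diff_right [symmetric]) (simp add: scaleR_add_left)
  finally show ?thesis .
qed

lemma geometric_decay:
  fixes L :: "nat \<Rightarrow> real"
  assumes "q \<ge> 0" and "\<And>n. L (Suc n) \<le> q * L n"
  shows "L n \<le> q ^ n * L 0"
proof (induction n)
  case (Suc n)
  have "L (Suc n) \<le> q * L n" by (rule assms(2))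
  also have "\<dots> \<le> q * (q ^ n * L 0)" by (rule mult_left_mono [OF Suc.IH assms(1)])
  finally show ?case by simp
qed simp

theorem theorem3:
  fixes \<alpha> s :: real
    and f :: "real ^ 'd \<Rightarrow> real"
    and xstar :: "real ^ 'd"
    and x v x' v' g \<delta> :: "nat \<Rightarrow> real ^ 'd"
  assumes "\<alpha> > 0" and "s > 0"
    and "is_arg_min f (\<lambda>_. True) xstar"
    and "\<And>n. x' n = x n + s *\<^sub>R v n"
    and "\<And>n. v' n = v n
          - inverse (1 + s * sqrt \<alpha>) *\<^sub>R ((s * sqrt \<alpha>) *\<^sub>R v n + s *\<^sub>R g n)
          - (s * sqrt \<alpha>) *\<^sub>R v' n"
    and "\<And>n. x (Suc n) = x' n - \<delta> n"
    and "\<And>n. v (Suc n) = v' n + (inverse (1 + s * sqrt \<alpha>) * sqrt \<alpha>) *\<^sub>R \<delta> n"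
    and "\<And>n z. f (x' n - \<delta> n) - f z
          \<le> g n \<bullet> (x' n - z) - \<alpha> / 2 * (norm (x' n - z))\<^sup>2 - s\<^sup>2 / 2 * (norm (g n))\<^sup>2"
  shows "(\<forall>n. lyapunov \<alpha> s f xstar (x (Suc n)) (v (Suc n))
            \<le> inverse (1 + s * sqrt \<alpha>) * lyapunov \<alpha> s f xstar (x n) (v n))
       \<and> (v 0 = 0 \<longrightarrow>
           (\<forall>n. f (x n) - f xstar
              \<le> (1 + s * sqrt \<alpha>) powi (- int n)
                  * (f (x 0) - f xstar + \<alpha> / 2 * (norm (x 0 - xstar))\<^sup>2)))"
proof -
  define k where "k = 1 + s * sqrt \<alpha>"
  have k: "k > 0"
    using assms(1,2) by (simp add: k_def add_pos_nonneg)
  have step: "lyapunov \<alpha> s f xstar (x (Suc n)) (v (Suc n))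
      \<le> inverse k * lyapunov \<alpha> s f xstar (x n) (v n)" for n
  proof -
    define y where "y = x' n - xstar"
    have v': "k *\<^sub>R v' n = inverse k *\<^sub>R (v n - s *\<^sub>R g n)"
      unfolding k_def using k assms(5) by (intro implicit_velocity_eq) (simp_all add: k_def)
    \<comment> \<open>The position contributes \<open>- sqrt \<alpha> *\<^sub>R \<delta> n\<close>,
      and the velocity, scaled by \<open>k\<close>, the opposite vector.\<close>
    have new: "sqrt \<alpha> *\<^sub>R (x (Suc n) - xstar) + k *\<^sub>R v (Suc n)
        = sqrt \<alpha> *\<^sub>R y + inverse k *\<^sub>R (v n - s *\<^sub>R g n)"
      using k unfolding v' [symmetric] assms(6,7) k_def [symmetric] y_def
      by (simp add: scaleR_add_right scaleR_diff_right)
    \<comment> \<open>The surplus \<open>(s * sqrt \<alpha>) *\<^sub>R v n\<close> in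
      \<open>k *\<^sub>R v n\<close> is what moves \<open>x n\<close> to
      \<open>x' n\<close>.\<close>
    have old: "sqrt \<alpha> *\<^sub>R (x n - xstar) + k *\<^sub>R v n = sqrt \<alpha> *\<^sub>R y + v n"
      unfolding y_def assms(4) k_def
      by (simp add: scaleR_add_right scaleR_diff_right scaleR_add_left mult.commute)
    have "f (x (Suc n)) - f xstar
        + 1 / 2 * (norm (sqrt \<alpha> *\<^sub>R y + inverse k *\<^sub>R (v n - s *\<^sub>R g n)))\<^sup>2
      \<le> inverse k * (f (x n) - f xstar + 1 / 2 * (norm (sqrt \<alpha> *\<^sub>R y + v n))\<^sup>2)"
      unfolding k_def
    proof (rule lyapunov_step_inner)
      show "f (x (Suc n)) - f xstar - (f (x n) - f xstar)
        \<le> g n \<bullet> (s *\<^sub>R v n) - (sqrt \<alpha>)\<^sup>2 / 2 * (norm (s *\<^sub>R v n))\<^sup>2 - s\<^sup>2 / 2 * (norm (g n))\<^sup>2"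
        using assms(8) [of n "x n"] assms(1) unfolding assms(6) by (simp add: assms(4))
      show "f (x (Suc n)) - f xstar
        \<le> g n \<bullet> y - (sqrt \<alpha>)\<^sup>2 / 2 * (norm y)\<^sup>2 - s\<^sup>2 / 2 * (norm (g n))\<^sup>2"
        using assms(8) [of n xstar] assms(1) unfolding assms(6) by (simp add: y_def)
    qed (use assms(1,2) in auto)
    then show ?thesis
      unfolding lyapunov_def k_def [symmetric] new old .
  qed
  have "f (x n) - f xstar
      \<le> k powi (- int n) * (f (x 0) - f xstar + \<alpha> / 2 * (norm (x 0 - xstar))\<^sup>2)"
    if "v 0 = 0" for n
  proof -
    have "f (x n) - f xstar \<le> lyapunov \<alpha> s f xstar (x n) (v n)"
      by (simp add: lyapunov_def)
    also have "\<dots> \<le> inverse k ^ n * lyapunov \<alpha> s f xstar (x 0) (v 0)"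
      using k by (intro geometric_decay [where L = "\<lambda>n. lyapunov \<alpha> s f xstar (x n) (v n)"] step) simp
    \<comment> \<open>With zero initial velocity only
      \<open>sqrt \<alpha> *\<^sub>R (x 0 - xstar)\<close> remains inside the norm.\<close>
    also have "lyapunov \<alpha> s f xstar (x 0) (v 0)
        = f (x 0) - f xstar + \<alpha> / 2 * (norm (x 0 - xstar))\<^sup>2"
      using that assms(1) by (simp add: lyapunov_def power_mult_distrib)
    also have "inverse k ^ n = k powi (- int n)"
      by (simp add: power_int_minus power_inverse)
    finally show ?thesis .
  qed
  with step show ?thesis
    unfolding k_def by blast
qed

end
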